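(* Let $f\in M$ have exactly one omitted value $a$. Suppose that $a\in\mathcal{J}(f)$ and that $\mathcal{J}_a$, the component of the Julia set containing $a$, is a singleton. If there are a Jordan curve $\gamma$ in the Fatou set $\mathcal{F}(f)$ that is non-contractible in $\mathcal{F}(f)$ and a subsequence $(m_k)$ of positive integers such that $\lim_{k\to\infty}f^{m_k}(\gamma)=\infty$ and $f^{m_k}(\gamma)$ surrounds $a$ for all large $k$, then $f$ has a Baker omitted value.
   Context: $\widehat{\mathbb{C}}=\mathbb{C}\cup\{\infty\}$, and $D_r(a)$ is the open ball centered at $a\in\widehat{\mathbb{C}}$ with radius $r$ with respect to the spherical metric. A point $a\in\widehat{\mathbb{C}}$ is an omitted value of $f$ if $f(z)\neq a$ for every $z\in\mathbb{C}$. $M$ denotes the class of transcendental meromorphic functions $f:\mathbb{C}\to\widehat{\mathbb{C}}$ (with a single essential singularity, at $\infty$) that have at least two poles or one pole that is not an omitted value. An omitted value $a\in\widehat{\mathbb{C}}$ of $f$ is a Baker omitted value (bov) if there exists $r_0>0$ such that for all $r$ with $0<r<r_0$, each component of the boundary of $f^{-1}(D_r(a))$ (boundary taken in $\mathbb{C}$) is bounded. The Fatou set $\mathcal{F}(f)$ is the set of $z\in\mathbb{C}$ having a neighborhood on which all iterates $\{f^n\}_{n>0}$ are defined and form a normal family (every sequence of iterates has a subsequence converging, uniformly on compact subsets, either to a finite limit function or to $\infty$). The Julia set is $\mathcal{J}(f)=\widehat{\mathbb{C}}\setminus\mathcal{F}(f)$. For $z\in\mathcal{J}(f)$, $\mathcal{J}_z$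 denotes the connected component of $\mathcal{J}(f)$ containing $z$. The closed curve $f^{m_k}(\gamma)$ surrounds $a$ if $a$ lies in a bounded component of $\mathbb{C}\setminus f^{m_k}(\gamma)$. The statement $\lim_{k\to\infty}f^{m_k}(\gamma)=\infty$ means $f^{m_k}\to\infty$ uniformly on $\gamma$. *)

theory Defs
  imports "HOL-Complex_Analysis.Complex_Analysis"
begin

text \<open>
  The Riemann sphere is the type \<^typ>\<open>complex option\<close>, with \<^term>\<open>None\<close> as the point at infinity;
  its topology is the one-point compactification \<^term>\<open>Alexandroff_compactification euclidean\<close>.
  A meromorphic function on the plane is a function \<open>f :: complex \<Rightarrow> complex\<close> that is
  nicely meromorphic on \<^term>\<open>UNIV\<close> (no removable singularities, and dummy value 0 at poles). The
  sphere-valued function it stands for is \<open>sphere_val f\<close> below.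
\<close>

definition sphere_val :: "(complex \<Rightarrow> complex) \<Rightarrow> complex \<Rightarrow> complex option" where
  "sphere_val f z = (if is_pole f z then None else Some (f z))"

text \<open>
  The geodesic distance on the unit sphere, transported by stereographic projection: the chord
  length is twice the argument of \<^term>\<open>arcsin\<close>.
\<close>

fun spherical_dist :: "complex option \<Rightarrow> complex option \<Rightarrow> real" where
  "spherical_dist (Some z) (Some w) =
     2 * arcsin (norm (z - w) / (sqrt (1 + (norm z)\<^sup>2) * sqrt (1 + (norm w)\<^sup>2)))"
| "spherical_dist (Some z) None = 2 * arcsin (1 / sqrt (1 + (norm z)\<^sup>2))"
| "spherical_dist None (Some w) = 2 * arcsin (1 / sqrt (1 + (norm w)\<^sup>2))"
| "spherical_dist None None = 0"

definition spherical_ball :: "complex option \<Rightarrow> real \<Rightarrow> complex option set" where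
  "spherical_ball a r = {w. spherical_dist a w < r}"

definition omitted_value :: "(complex \<Rightarrow> complex) \<Rightarrow> complex option \<Rightarrow> bool" where
  "omitted_value f a \<longleftrightarrow> (\<forall>z. sphere_val f z \<noteq> a)"

definition rational_function :: "(complex \<Rightarrow> complex) \<Rightarrow> bool" where
  "rational_function f \<longleftrightarrow>
     (\<exists>p q :: complex poly. q \<noteq> 0 \<and> (\<forall>z. poly q z \<noteq> 0 \<longrightarrow> f z = poly p z / poly q z))"

definition transcendental_meromorphic :: "(complex \<Rightarrow> complex) \<Rightarrow> bool" where
  "transcendental_meromorphic f \<longleftrightarrow> f nicely_meromorphic_on UNIV \<and> \<not> rational_function f"

definition class_M :: "(complex \<Rightarrow> complex) set" where
  "class_M = {f. transcendental_meromorphic f \<and>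
     ((\<exists>z w. z \<noteq> w \<and> is_pole f z \<and> is_pole f w) \<or>
      (\<exists>p. is_pole f p \<and> \<not> omitted_value f (Some p)))}"

definition baker_omitted_value :: "(complex \<Rightarrow> complex) \<Rightarrow> complex option \<Rightarrow> bool" where
  "baker_omitted_value f a \<longleftrightarrow> omitted_value f a \<and>
     (\<exists>r\<^sub>0>0. \<forall>r. 0 < r \<and> r < r\<^sub>0 \<longrightarrow>
        (\<forall>C \<in> components (frontier (sphere_val f -` spherical_ball a r)). bounded C))"

text \<open>
  All iterates are defined at \<open>z\<close> iff the orbit never meets a pole. In that case the iterates
  are finite, and the usual powers \<open>f ^^ n\<close> do not see the dummy value of \<open>f\<close> at its poles.
\<close>

definition iterates_defined :: "(complex \<Rightarrow> complex) \<Rightarrow> complex \<Rightarrow> bool" where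
  "iterates_defined f z \<longleftrightarrow> (\<forall>n. \<not> is_pole f ((f ^^ n) z))"

definition uniformly_to_infinity_on ::
    "complex set \<Rightarrow> (nat \<Rightarrow> complex \<Rightarrow> complex) \<Rightarrow> bool" where
  "uniformly_to_infinity_on K g \<longleftrightarrow>
     (\<forall>B::real. \<forall>\<^sub>F k in sequentially. \<forall>z\<in>K. norm (g k z) > B)"

text \<open>
  The sequence \<open>s\<close> of indices is arbitrary: it may repeat indices and need not be increasing.
\<close>

definition iterates_normal_on :: "(complex \<Rightarrow> complex) \<Rightarrow> complex set \<Rightarrow> bool" where
  "iterates_normal_on f U \<longleftrightarrow>
     (\<forall>s :: nat \<Rightarrow> nat. (\<forall>k. s k > 0) \<longrightarrow>
       (\<exists>r :: nat \<Rightarrow> nat. strict_mono r \<and>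
         ((\<exists>g. \<forall>K. compact K \<and> K \<subseteq> U \<longrightarrow>
              uniform_limit K (\<lambda>k. f ^^ s (r k)) g sequentially) \<or>
          (\<forall>K. compact K \<and> K \<subseteq> U \<longrightarrow>
              uniformly_to_infinity_on K (\<lambda>k. f ^^ s (r k))))))"

definition fatou_set :: "(complex \<Rightarrow> complex) \<Rightarrow> complex set" where
  "fatou_set f = {z. \<exists>U. open U \<and> z \<in> U \<and>
     (\<forall>w\<in>U. iterates_defined f w) \<and> iterates_normal_on f U}"

definition julia_set :: "(complex \<Rightarrow> complex) \<Rightarrow> complex option set" where
  "julia_set f = UNIV - Some ` fatou_set f"

definition julia_component ::
    "(complex \<Rightarrow> complex) \<Rightarrow> complex option \<Rightarrow> complex option set" where
  "julia_component f a =
     connected_component_of_set (subtopology (Alexandroff_compactification euclidean) (julia_set f)) a"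

definition jordan_curve :: "(real \<Rightarrow> complex) \<Rightarrow> bool" where
  "jordan_curve \<gamma> \<longleftrightarrow> simple_path \<gamma> \<and> pathfinish \<gamma> = pathstart \<gamma>"

definition contractible_loop_in :: "complex set \<Rightarrow> (real \<Rightarrow> complex) \<Rightarrow> bool" where
  "contractible_loop_in S \<gamma> \<longleftrightarrow> (\<exists>c. homotopic_loops S \<gamma> (linepath c c))"

definition surrounds :: "complex set \<Rightarrow> complex option \<Rightarrow> bool" where
  "surrounds K a \<longleftrightarrow> (\<exists>C \<in> components (- K). bounded C \<and> a \<in> Some ` C)"

end

theory Submission
  imports Defs
begin

text \<open>
  The omitted value \<open>a\<close> is finite because some curve surrounds it, so \<open>h = 1 / (f - a)\<close> is entire.
  The curves \<open>(f ^^ m k) \<circ> \<gamma>\<close> surround larger and larger discs; if \<open>f\<close> stayed away from \<open>a\<close> on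
  infinitely many of them, \<open>h\<close> would be bounded by the maximum principle, hence constant by Liouville,
  and \<open>f\<close> would be rational. By normality the functions \<open>f ^^ Suc (m k)\<close> subconverge near \<open>\<gamma>\<close>,
  and a finite limit is constant because \<open>f ^^ m k\<close> escapes; the only limit that does not keep \<open>f\<close>
  away from \<open>a\<close> on the curves is \<open>a\<close> itself. So \<open>f\<close> tends to \<open>a\<close> along the curves, which therefore lie in
  the open set \<open>f\<^sup>-\<^sup>1(D\<^sub>r(a))\<close> eventually, and no unbounded connected subset of its boundary can cross them.
\<close>

section \<open>Holomorphy of the iterates and of the reciprocal
  \<open>1 / (f - \<alpha>)\<close>\<close>

lemma nicely_meromorphic_on_imp_holomorphic_on:
  assumes "f nicely_meromorphic_on UNIV" "\<And>z. z \<in> S \<Longrightarrow> \<not> is_pole f z"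
  shows "f holomorphic_on S"
proof -
  have "f analytic_on S"
    using nicely_meromorphic_on_imp_analytic_at[OF assms(1) UNIV_I] assms(2)
    by (subst analytic_on_analytic_at) simp
  then show ?thesis
    by (rule analytic_imp_holomorphic)
qed

lemma iterates_defined_funpow:
  assumes "iterates_defined f z"
  shows "iterates_defined f ((f ^^ n) z)"
  using assms unfolding iterates_defined_def by (metis comp_apply funpow_add)

lemma holomorphic_on_funpow:
  assumes "f nicely_meromorphic_on UNIV" "\<And>z. z \<in> S \<Longrightarrow> iterates_defined f z"
  shows "(f ^^ n) holomorphic_on S"
proof (induction n)
  case 0
  show ?case by (simp add: id_def)
next
  case (Suc n)
  have "f holomorphic_on (f ^^ n) ` S"
    using assms by (intro nicely_meromorphic_on_imp_holomorphic_on) (auto simp: iterates_defined_def)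
  with Suc show ?case
    using holomorphic_on_compose[of "f ^^ n" S f] by (simp add: o_def)
qed

lemma open_nonpoles:
  assumes "f nicely_meromorphic_on UNIV"
  shows "open {z. \<not> is_pole f z}"
proof -
  have "{z. \<not> is_pole f z} = {z. f analytic_on {z}}"
    using nicely_meromorphic_on_imp_analytic_at[OF assms UNIV_I] analytic_at_imp_no_pole by auto
  moreover have "open {z. f analytic_on {z}}"
  proof (subst open_subopen, intro ballI)
    fix z assume "z \<in> {z. f analytic_on {z}}"
    then obtain S where S: "open S" "z \<in> S" "f holomorphic_on S"
      by (auto simp: analytic_at)
    then show "\<exists>T. open T \<and> z \<in> T \<and> T \<subseteq> {z. f analytic_on {z}}"
      by (intro exI[of _ S]) (auto simp: analytic_at)
  qed
  ultimately show ?thesis by simp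
qed

text \<open>Away from the poles the denominator has no zeros because \<open>\<alpha>\<close> is
  omitted. Each pole is isolated, and there the reciprocal has a removable singularity with value
  0.\<close>

lemma holomorphic_inverse_of_omitted:
  assumes f: "f nicely_meromorphic_on UNIV" and om: "omitted_value f (Some \<alpha>)"
  shows "(\<lambda>z. if is_pole f z then 0 else inverse (f z - \<alpha>)) holomorphic_on UNIV"
    (is "?h holomorphic_on _")
proof -
  have neq: "f z - \<alpha> \<noteq> 0" if "\<not> is_pole f z" for z
    using om[unfolded omitted_value_def sphere_val_def, rule_format, of z] that by auto
  have "\<exists>S. open S \<and> z \<in> S \<and> ?h holomorphic_on S" for z
  proof (cases "is_pole f z")
    case False
    have "(\<lambda>z. inverse (f z - \<alpha>)) holomorphic_on {z. \<not> is_pole f z}"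
      using neq by (intro holomorphic_intros nicely_meromorphic_on_imp_holomorphic_on[OF f]) auto
    then have "?h holomorphic_on {z. \<not> is_pole f z}"
      by (rule holomorphic_transform) auto
    with False open_nonpoles[OF f] show ?thesis by blast
  next
    case True
    have "isolated_singularity_at f z"
      using f by (auto simp: nicely_meromorphic_on_def meromorphic_on_altdef)
    then obtain r where r: "r > 0" "f analytic_on ball z r - {z}"
      by (auto simp: isolated_singularity_at_def)
    have np: "\<not> is_pole f w" if "w \<in> ball z r - {z}" for w
      using r that not_is_pole_holomorphic[of "ball z r - {z}" w f] analytic_imp_holomorphic
      by (metis open_ball open_delete)
    have "filterlim (\<lambda>w. - \<alpha> + f w) at_infinity (at z)"
      using True unfolding is_pole_def by (intro tendsto_add_filterlim_at_infinity) auto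
    then have pole: "is_pole (\<lambda>w. f w - \<alpha>) z"
      by (simp add: is_pole_def)
    have "(\<lambda>w. if w = z then 0 else inverse (f w - \<alpha>)) holomorphic_on ball z r"
      using r pole np neq
      by (intro is_pole_inverse_holomorphic) (auto intro!: holomorphic_on_diff dest: analytic_imp_holomorphic)
    then have "?h holomorphic_on ball z r"
      by (rule holomorphic_transform) (use True np in auto)
    with r show ?thesis by (metis centre_in_ball open_ball)
  qed
  then have "?h analytic_on {z}" for z
    by (simp add: analytic_at)
  then have "?h analytic_on UNIV"
    by (subst analytic_on_analytic_at) blast
  then show ?thesis
    by (rule analytic_imp_holomorphic)
qed

text \<open>
  At a pole the dummy value of \<open>f\<close> is 0, so constancy of the inverse determines \<open>f\<close> everywhere.
\<close>

lemma rational_function_if_inverse_constant: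
  assumes f: "f nicely_meromorphic_on UNIV"
    and c: "\<And>z. (if is_pole f z then 0 else inverse (f z - \<alpha>)) = c"
  shows "rational_function f"
proof -
  have "\<exists>d. \<forall>z. f z = d"
  proof (cases "c = 0")
    case True
    have f_eq: "f z = (if is_pole f z then 0 else \<alpha>)" for z
      using c[of z] f True not_tendsto_and_filterlim_at_infinity[OF at_neq_bot, of f "f z" z]
      by (auto simp: is_pole_def nicely_meromorphic_on_def)
    \<comment> \<open>By \<open>f_eq\<close> the only possible values are 0 and
      \<open>\<alpha>\<close>, so \<open>f\<close> is bounded, whereas near a pole it is
      not.\<close>
    have "\<not> is_pole f z" for z
    proof
      assume "is_pole f z"
      then have "\<forall>\<^sub>F w in at z. norm (f w) \<ge> norm \<alpha> + 1"
        by (metis add_nonneg_pos filterlim_at_infinity is_pole_def norm_ge_zero order_refl zero_less_one)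
      moreover have "norm (f w) \<le> norm \<alpha>" for w
        by (subst f_eq) auto
      ultimately have "\<forall>\<^sub>F w in at z. False"
        by (elim eventually_mono) (smt (verit))
      then show False by simp
    qed
    with f_eq show ?thesis by auto
  next
    case False
    \<comment> \<open>A nonzero \<open>c\<close> rules out poles, since the reciprocal is 0
      there.\<close>
    have "f z = \<alpha> + inverse c" for z
      using c[of z] False by (auto split: if_splits)
    then show ?thesis by blast
  qed
  then obtain d where "\<And>z. f z = d" by blast
  then show ?thesis
    unfolding rational_function_def by (intro exI[of _ "[:d:]"] exI[of _ 1]) auto
qed

section \<open>Maximum principle and Liouville's theorem on surrounding sets\<close>

lemma norm_le_on_bounded_complement_component:
  fixes h :: "complex \<Rightarrow> complex"
  assumes "h holomorphic_on UNIV" "closed K" "C \<in> components (- K)" "bounded C"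
    and B: "\<And>w. w \<in> K \<Longrightarrow> norm (h w) \<le> B" and "z \<in> C"
  shows "norm (h z) \<le> B"
proof (rule maximum_modulus_frontier[of h C])
  have "frontier C \<subseteq> K"
    using assms frontier_of_components_closed_complement by blast
  then show "norm (h w) \<le> B" if "w \<in> frontier C" for w
    using B that by blast
qed (use assms in \<open>auto intro: holomorphic_on_subset holomorphic_on_imp_continuous_on\<close>)

text \<open>The disc is connected, misses \<open>K\<close> and meets \<open>C\<close> in
  \<open>\<alpha>\<close>. This turns surrounding the single point \<open>\<alpha>\<close> into
  surrounding whole discs.\<close>

lemma cball_subset_complement_component:
  fixes K :: "complex set"
  assumes "C \<in> components (- K)" "\<alpha> \<in> C" "norm \<alpha> \<le> R" "\<And>w. w \<in> K \<Longrightarrow> norm w > R"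
  shows "cball 0 R \<subseteq> C"
  by (rule components_maximal[OF assms(1)]) (use assms in force)+

text \<open>Since \<open>B\<close> does not depend on \<open>R\<close>, the maximum principle inside
  ever larger surrounding sets gives one bound for the whole plane, and Liouville's theorem
  applies.\<close>

lemma entire_bounded_on_surrounding_sets_imp_constant:
  fixes h :: "complex \<Rightarrow> complex"
  assumes h: "h holomorphic_on UNIV"
    and ex: "\<And>R. \<exists>K. closed K \<and> surrounds K (Some \<alpha>) \<and> (\<forall>w\<in>K. norm w > R \<and> norm (h w) \<le> B)"
  obtains c where "\<And>z. h z = c"
proof -
  have "norm (h z) \<le> B" for z
  proof -
    \<comment> \<open>This radius puts both \<open>\<alpha>\<close> and \<open>z\<close> into the
      disc, hence into the same complementary component.\<close>
    define R where "R = max (norm \<alpha>) (norm z)"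
    obtain K C where K: "closed K" "C \<in> components (- K)" "bounded C" "\<alpha> \<in> C"
        "\<And>w. w \<in> K \<Longrightarrow> norm w > R \<and> norm (h w) \<le> B"
      using ex[of R] by (auto simp: surrounds_def)
    have "z \<in> C"
      using cball_subset_complement_component[of C K \<alpha> R] K by (auto simp: R_def)
    then show ?thesis
      using norm_le_on_bounded_complement_component[OF h K(1-3)] K by blast
  qed
  then have "bounded (range h)"
    by (auto simp: bounded_iff)
  then have "h constant_on UNIV"
    by (rule Liouville_theorem[OF h])
  then show thesis
    using that by (auto simp: constant_on_def)
qed

section \<open>Normality of the iterates near a compact connected subset of the Fatou set\<close>

text \<open>The two alternatives of normality for one fixed sequence of indices, with uniformity on
  all of \<open>K\<close>, so that finitely many sets can be combined.\<close>

definition iterates_converge_on ::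
    "(complex \<Rightarrow> complex) \<Rightarrow> complex set \<Rightarrow> (nat \<Rightarrow> nat) \<Rightarrow> bool" where
  "iterates_converge_on f K s \<longleftrightarrow>
     (\<exists>g. uniform_limit K (\<lambda>k. f ^^ s k) g sequentially) \<or>
     uniformly_to_infinity_on K (\<lambda>k. f ^^ s k)"

lemma uniformly_to_infinity_on_subseq:
  assumes "uniformly_to_infinity_on K F" "strict_mono (r :: nat \<Rightarrow> nat)"
  shows "uniformly_to_infinity_on K (\<lambda>k. F (r k))"
  using assms(1) eventually_subseq[OF assms(2)] unfolding uniformly_to_infinity_on_def by blast

lemma uniform_limit_subseq:
  fixes F :: "nat \<Rightarrow> 'a \<Rightarrow> 'b::metric_space"
  assumes "uniform_limit K F g sequentially" "strict_mono (r :: nat \<Rightarrow> nat)"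
  shows "uniform_limit K (\<lambda>k. F (r k)) g sequentially"
  using filterlim_compose[OF assms(1) filterlim_subseq[OF assms(2)]] by simp

lemma iterates_converge_on_subseq:
  assumes "iterates_converge_on f K s" "strict_mono r"
  shows "iterates_converge_on f K (\<lambda>k. s (r k))"
  using assms uniform_limit_subseq[where K = K and F = "\<lambda>k. f ^^ s k" and r = r]
    uniformly_to_infinity_on_subseq[of K "\<lambda>k. f ^^ s k" r]
  unfolding iterates_converge_on_def by blast

text \<open>Subsequences are extracted one compact set after another; convergence already achieved
  passes to each further subsequence.\<close>

lemma common_convergent_subsequence:
  assumes "finite \<K>" "\<And>k. s k > 0"
    and "\<And>K. K \<in> \<K> \<Longrightarrow> compact K \<and> (\<exists>U. K \<subseteq> U \<and> iterates_normal_on f U)"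
  shows "\<exists>r :: nat \<Rightarrow> nat. strict_mono r \<and> (\<forall>K\<in>\<K>. iterates_converge_on f K (\<lambda>k. s (r k)))"
  using assms(1,3)
proof (induction \<K> rule: finite_induct)
  case empty
  show ?case using strict_mono_id by auto
next
  case (insert K \<K>)
  then obtain r :: "nat \<Rightarrow> nat"
    where r: "strict_mono r" "\<And>L. L \<in> \<K> \<Longrightarrow> iterates_converge_on f L (\<lambda>k. s (r k))"
    by auto
  obtain U where U: "compact K" "K \<subseteq> U" "iterates_normal_on f U"
    using insert.prems by blast
  obtain t :: "nat \<Rightarrow> nat" where t: "strict_mono t"
      "iterates_converge_on f K (\<lambda>k. s (r (t k)))"
    using U(3)[unfolded iterates_normal_on_def, rule_format, of "\<lambda>k. s (r k)"] assms(2) U(1,2)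
    unfolding iterates_converge_on_def by blast
  have "strict_mono (\<lambda>k. r (t k))"
    using r(1) t(1) by (auto simp: strict_mono_def)
  moreover have "iterates_converge_on f L (\<lambda>k. s (r (t k)))" if "L \<in> insert K \<K>" for L
    using that t iterates_converge_on_subseq[OF r(2) t(1)] by auto
  ultimately show ?case by (intro exI[of _ "\<lambda>k. r (t k)"]) auto
qed

lemma uniformly_to_infinity_on_imp_filterlim:
  assumes "uniformly_to_infinity_on K F" "z \<in> K"
  shows "filterlim (\<lambda>k. F k z) at_infinity sequentially"
proof -
  have "\<forall>\<^sub>F k in sequentially. norm (F k z) \<ge> B" for B
    using assms unfolding uniformly_to_infinity_on_def
    by (auto elim!: allE[of _ B] eventually_mono intro: less_imp_le)
  then show ?thesis
    using filterlim_at_infinity[of 0 "\<lambda>k. F k z" sequentially] by simp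
qed

text \<open>Discs with a finite limit cannot meet discs with limit infinity, so by connectedness one
  alternative holds on all of them. Open discs serve the connectedness argument, closed ones carry
  the convergence.\<close>

lemma finite_union_iterates_converge:
  assumes "finite Z" "connected (\<Union>z\<in>Z. ball z (e z))"
    and e: "\<And>z. z \<in> Z \<Longrightarrow> e z > 0"
    and conv: "\<And>z. z \<in> Z \<Longrightarrow> iterates_converge_on f (cball z (e z)) s"
  shows "iterates_converge_on f (\<Union>z\<in>Z. ball z (e z)) s"
proof -
  let ?V = "\<Union>z\<in>Z. ball z (e z)"
  define A where "A = {z\<in>Z. uniformly_to_infinity_on (cball z (e z)) (\<lambda>k. f ^^ s k)}"
  define B where "B = {z\<in>Z. \<exists>g. uniform_limit (cball z (e z)) (\<lambda>k. f ^^ s k) g sequentially}"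
  have ZAB: "Z = A \<union> B"
    using conv by (auto simp: A_def B_def iterates_converge_on_def)
  have convB: "convergent (\<lambda>k. (f ^^ s k) w)" if "z \<in> B" "w \<in> cball z (e z)" for z w
  proof -
    from that obtain g where "uniform_limit (cball z (e z)) (\<lambda>k. f ^^ s k) g sequentially"
      by (auto simp: B_def)
    then show ?thesis
      using that(2) tendsto_uniform_limitI convergentI by metis
  qed
  have disj: "ball x (e x) \<inter> ball y (e y) = {}" if xy: "x \<in> A" "y \<in> B" for x y
  proof (rule ccontr)
    assume "\<not> ?thesis"
    then obtain w where w: "w \<in> ball x (e x)" "w \<in> ball y (e y)" by blast
    have "filterlim (\<lambda>k. (f ^^ s k) w) at_infinity sequentially"
      using xy(1) w(1) by (intro uniformly_to_infinity_on_imp_filterlim[of "cball x (e x)"]) (auto simp: A_def)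
    moreover obtain l where "(\<lambda>k. (f ^^ s k) w) \<longlonglongrightarrow> l"
      using convB[OF xy(2), of w] w(2) by (auto simp: convergent_def)
    ultimately show False
      using not_tendsto_and_filterlim_at_infinity[OF sequentially_bot] by blast
  qed
  define X where "X = (\<Union>z\<in>A. ball z (e z))"
  define Y where "Y = (\<Union>z\<in>B. ball z (e z))"
  have XY: "open X" "open Y" "X \<inter> Y = {}" "?V = X \<union> Y"
    using disj ZAB by (auto simp: X_def Y_def)
  then have "X \<inter> ?V = {} \<or> Y \<inter> ?V = {}"
    by (intro connectedD[OF assms(2)]) auto
  then have "X = {} \<or> Y = {}"
    using XY(4) by auto
  moreover have "X \<noteq> {}" if z: "z \<in> A" for z
    using e[of z] z ZAB by (auto simp: X_def intro!: bexI[of _ z])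
  moreover have "Y \<noteq> {}" if z: "z \<in> B" for z
    using e[of z] z ZAB by (auto simp: Y_def intro!: bexI[of _ z])
  ultimately have "A = {} \<or> B = {}"
    by blast
  then show ?thesis
  proof
    assume "A = {}"
    \<comment> \<open>The limits on the single discs are all pointwise limits of the same sequence,
      so they glue to one function.\<close>
    define g where "g w = lim (\<lambda>k. (f ^^ s k) w)" for w
    have "uniform_limit (cball z (e z)) (\<lambda>k. f ^^ s k) g sequentially" if z: "z \<in> Z" for z
    proof -
      have "z \<in> B" using z ZAB \<open>A = {}\<close> by simp
      then obtain g' where g': "uniform_limit (cball z (e z)) (\<lambda>k. f ^^ s k) g' sequentially"
        unfolding B_def by blast
      have "g' w = g w" if "w \<in> cball z (e z)" for w
        using limI[OF tendsto_uniform_limitI[OF g' that]] by (simp add: g_def)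
      then show ?thesis
        by (intro uniform_limit_cong'[THEN iffD1, OF _ _ g']) auto
    qed
    then have "uniform_limit (\<Union>z\<in>Z. cball z (e z)) (\<lambda>k. f ^^ s k) g sequentially"
      using \<open>finite Z\<close> by (intro uniform_limit_on_UNION) auto
    then have "uniform_limit ?V (\<lambda>k. f ^^ s k) g sequentially"
      by (rule uniform_limit_on_subset) (use ball_subset_cball in blast)
    then show ?thesis by (auto simp: iterates_converge_on_def)
  next
    assume "B = {}"
    have inf: "\<forall>\<^sub>F k in sequentially. \<forall>z\<in>Z. \<forall>w\<in>cball z (e z). norm ((f ^^ s k) w) > C" for C
    proof (intro eventually_ball_finite[OF \<open>finite Z\<close>] ballI)
      fix z assume "z \<in> Z"
      then have "z \<in> A" using ZAB \<open>B = {}\<close> by simp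
      then have "uniformly_to_infinity_on (cball z (e z)) (\<lambda>k. f ^^ s k)"
        by (simp add: A_def)
      then show "\<forall>\<^sub>F k in sequentially. \<forall>w\<in>cball z (e z). norm ((f ^^ s k) w) > C"
        unfolding uniformly_to_infinity_on_def by blast
    qed
    have "uniformly_to_infinity_on ?V (\<lambda>k. f ^^ s k)"
      unfolding uniformly_to_infinity_on_def
    proof
      fix C show "\<forall>\<^sub>F k in sequentially. \<forall>w\<in>?V. norm ((f ^^ s k) w) > C"
        using inf[of C] by eventually_elim auto
    qed
    then show ?thesis by (auto simp: iterates_converge_on_def)
  qed
qed

text \<open>A finite cover of \<open>G\<close> by small discs yields \<open>V\<close>. It is fixed
  before the sequence \<open>s\<close>, so several extractions can be made on the same
  \<open>V\<close>.\<close>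

lemma uniformly_normal_neighbourhood:
  assumes G: "compact G" "connected G" "G \<noteq> {}" "G \<subseteq> fatou_set f"
  obtains V where "open V" "connected V" "G \<subseteq> V" "\<And>z. z \<in> V \<Longrightarrow> iterates_defined f z"
    "\<And>s :: nat \<Rightarrow> nat. (\<And>k. s k > 0) \<Longrightarrow>
       \<exists>r :: nat \<Rightarrow> nat. strict_mono r \<and> iterates_converge_on f V (\<lambda>k. s (r k))"
proof -
  have "\<exists>e U. e > 0 \<and> cball z e \<subseteq> U \<and> iterates_normal_on f U \<and> (\<forall>w\<in>U. iterates_defined f w)"
    if z: "z \<in> G" for z
  proof -
    obtain U where U: "open U" "z \<in> U" "\<forall>w\<in>U. iterates_defined f w" "iterates_normal_on f U"
      using z G(4) unfolding fatou_set_def by blast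
    obtain e where "e > 0" "cball z e \<subseteq> U"
      using U(1,2) open_contains_cball_eq by metis
    with U(3,4) show ?thesis by blast
  qed
  then obtain e U where eU: "\<And>z. z \<in> G \<Longrightarrow> e z > 0" "\<And>z. z \<in> G \<Longrightarrow> cball z (e z) \<subseteq> U z"
      "\<And>z. z \<in> G \<Longrightarrow> iterates_normal_on f (U z)"
      "\<And>z w. z \<in> G \<Longrightarrow> w \<in> U z \<Longrightarrow> iterates_defined f w"
    by metis
  have "G \<subseteq> (\<Union>z\<in>G. ball z (e z))" using eU(1) by force
  then obtain Z where Z: "Z \<subseteq> G" "finite Z" "G \<subseteq> (\<Union>z\<in>Z. ball z (e z))"
    using compactE_image[OF G(1), of G "\<lambda>z. ball z (e z)"] by auto
  define V where "V = (\<Union>z\<in>Z. ball z (e z))"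
  \<comment> \<open>Adding \<open>G\<close> to every disc does not change the union, and it makes
    all the pieces connected with a common nonempty part.\<close>
  have "V = (\<Union>z\<in>Z. G \<union> ball z (e z))"
    using Z G(3) by (auto simp: V_def)
  moreover have "connected (\<Union>z\<in>Z. G \<union> ball z (e z))"
  proof (rule connected_Union)
    show "connected S" if S: "S \<in> (\<lambda>z. G \<union> ball z (e z)) ` Z" for S
    proof -
      obtain z where "z \<in> Z" "S = G \<union> ball z (e z)" using S by blast
      moreover have "z \<in> G \<inter> ball z (e z)" using \<open>z \<in> Z\<close> Z(1) eU(1) by auto
      ultimately show ?thesis using G(2) by (metis connected_Un connected_ball empty_iff)
    qed
    show "\<Inter> ((\<lambda>z. G \<union> ball z (e z)) ` Z) \<noteq> {}"
      using G(3) by blast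
  qed
  ultimately have conn: "connected V" by simp
  show thesis
  proof (rule that[of V])
    show "open V" by (auto simp: V_def)
    show "G \<subseteq> V" using Z by (simp add: V_def)
    show "iterates_defined f z" if "z \<in> V" for z
      using that Z(1) eU(2,4) ball_subset_cball unfolding V_def by blast
    show "\<exists>r :: nat \<Rightarrow> nat. strict_mono r \<and> iterates_converge_on f V (\<lambda>k. s (r k))"
      if s: "\<And>k. s k > 0" for s :: "nat \<Rightarrow> nat"
    proof -
      have "compact K \<and> (\<exists>U. K \<subseteq> U \<and> iterates_normal_on f U)"
        if K: "K \<in> (\<lambda>z. cball z (e z)) ` Z" for K
      proof -
        obtain z where "z \<in> G" "K = cball z (e z)" using K Z(1) by blast
        then show ?thesis using eU(2,3) by auto
      qed
      then obtain r :: "nat \<Rightarrow> nat" where r: "strict_mono r"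
          "\<forall>K\<in>(\<lambda>z. cball z (e z)) ` Z. iterates_converge_on f K (\<lambda>k. s (r k))"
        using common_convergent_subsequence[of "(\<lambda>z. cball z (e z)) ` Z" s f, OF finite_imageI[OF Z(2)] s] by auto
      have "iterates_converge_on f V (\<lambda>k. s (r k))"
        unfolding V_def
      proof (rule finite_union_iterates_converge)
        show "connected (\<Union>z\<in>Z. ball z (e z))" using conn by (simp add: V_def)
      qed (use Z eU(1) r(2) in auto)
      with r(1) show ?thesis by blast
    qed
  qed (rule conn)
qed

section \<open>Limits of the iterates along escaping curves\<close>

text \<open>
  If the limit were not constant, Hurwitz's theorem would give a point \<open>\<zeta>\<close> whose limit value
  lies in the image of \<open>V\<close> under one of the iterates. Points of that image escape along
  \<open>f ^^ (m l - m k - 1)\<close>, but the point \<open>w = (f ^^ Suc (m k)) \<zeta>\<close> nearly returns to it, and iterating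
  continuously from the return point yields a finite limit of the same iterates.
\<close>

lemma limit_after_escape_constant:
  fixes m :: "nat \<Rightarrow> nat"
  assumes f: "f nicely_meromorphic_on UNIV"
    and V: "open V" "connected V" and def: "\<And>z. z \<in> V \<Longrightarrow> iterates_defined f z"
    and m: "strict_mono m"
    and esc: "\<And>z. z \<in> V \<Longrightarrow> filterlim (\<lambda>k. (f ^^ m k) z) at_infinity sequentially"
    and lim: "uniform_limit V (\<lambda>k. f ^^ Suc (m k)) g sequentially"
  shows "g constant_on V"
proof (rule ccontr)
  assume nc: "\<not> g constant_on V"
  have ptw: "(\<lambda>k. (f ^^ Suc (m k)) z) \<longlonglongrightarrow> g z" if "z \<in> V" for z
    using lim that by (rule tendsto_uniform_limitI)
  have hol: "(f ^^ n) holomorphic_on V" for n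
    using f def by (rule holomorphic_on_funpow)
  have holg: "g holomorphic_on V"
  proof (rule holomorphic_uniform_sequence[OF V(1) hol])
    fix x assume "x \<in> V"
    then show "\<exists>d>0. cball x d \<subseteq> V \<and> uniform_limit (cball x d) (\<lambda>k. f ^^ Suc (m k)) g sequentially"
      using V(1) open_contains_cball uniform_limit_on_subset[OF lim] by blast
  qed
  have split: "(f ^^ Suc (m l)) z = (f ^^ (m l - m k)) ((f ^^ Suc (m k)) z)" if "k \<le> l" for k l z
  proof -
    have "Suc (m l) = (m l - m k) + Suc (m k)"
      using strict_mono_leD[OF m that] by simp
    then show ?thesis by (metis comp_apply funpow_add)
  qed
  have split': "(f ^^ m l) z = (f ^^ (m l - Suc (m k))) ((f ^^ Suc (m k)) z)" if "k < l" for k l z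
  proof -
    have "m l = (m l - Suc (m k)) + Suc (m k)"
      using strict_monoD[OF m that] by simp
    then show ?thesis by (metis comp_apply funpow_add)
  qed
  \<comment> \<open>If one of these iterates were constant, every later one would agree at any two
    points of \<open>V\<close>, and so would \<open>g\<close>.\<close>
  have ncF: "\<not> (f ^^ Suc (m k)) constant_on V" for k
  proof
    assume "(f ^^ Suc (m k)) constant_on V"
    then obtain c where c: "\<And>z. z \<in> V \<Longrightarrow> (f ^^ Suc (m k)) z = c"
      by (auto simp: constant_on_def)
    have "g x = g y" if "x \<in> V" "y \<in> V" for x y
    proof -
      have "\<forall>\<^sub>F l in sequentially. (f ^^ Suc (m l)) x = (f ^^ Suc (m l)) y"
        using eventually_ge_at_top[of k]
        by eventually_elim (metis c split that)
      then have "(\<lambda>l. (f ^^ Suc (m l)) y) \<longlonglongrightarrow> g x"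
        by (rule Lim_transform_eventually[OF ptw[OF that(1)]])
      then show ?thesis
        using ptw[OF that(2)] by (rule LIMSEQ_unique)
    qed
    then show False
      using nc by (metis constant_on_def)
  qed
  obtain \<zeta> where \<zeta>: "\<zeta> \<in> V" using nc by (auto simp: constant_on_def)
  obtain k where k: "g \<zeta> \<in> (f ^^ Suc (m k)) ` V"
  proof (rule ccontr)
    assume "\<not> thesis"
    then have no: "g \<zeta> \<notin> (f ^^ Suc (m k)) ` V" for k
      using that by blast
    \<comment> \<open>The approximating functions have no zeros in \<open>V\<close> and the limit is
      not constant, so by Hurwitz the limit would have no zeros either; yet it vanishes at
      \<open>\<zeta>\<close>.\<close>
    have "g \<zeta> - g \<zeta> \<noteq> 0"
    proof (rule Hurwitz_no_zeros[of V "\<lambda>k z. (f ^^ Suc (m k)) z - g \<zeta>" "\<lambda>z. g z - g \<zeta>"])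
      show "(\<lambda>z. (f ^^ Suc (m k)) z - g \<zeta>) holomorphic_on V" for k
        by (intro holomorphic_on_diff hol holomorphic_on_const)
      show "(\<lambda>z. g z - g \<zeta>) holomorphic_on V"
        by (intro holomorphic_on_diff holg holomorphic_on_const)
      show "uniform_limit K (\<lambda>k z. (f ^^ Suc (m k)) z - g \<zeta>) (\<lambda>z. g z - g \<zeta>) sequentially"
        if "K \<subseteq> V" for K
        using uniform_limit_on_subset[OF lim that] by (intro uniform_limit_intros)
      show "\<not> (\<lambda>z. g z - g \<zeta>) constant_on V"
        using nc by (auto simp: constant_on_def) (metis diff_add_cancel)
      show "(f ^^ Suc (m k)) z - g \<zeta> \<noteq> 0" if "z \<in> V" for k z
        using no that by (metis eq_iff_diff_eq_0 image_eqI)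
    qed (use V \<zeta> in auto)
    then show False by simp
  qed
  define w where "w = (f ^^ Suc (m k)) \<zeta>"
  define W where "W = (f ^^ Suc (m k)) ` V"
  have "open W"
    unfolding W_def by (rule open_mapping_thm[OF hol V V(1) order_refl ncF])
  have defW: "iterates_defined f v" if "v \<in> W" for v
    using that def iterates_defined_funpow unfolding W_def by blast
  have escW: "filterlim (\<lambda>l. (f ^^ (m l - Suc (m k))) v) at_infinity sequentially" if v: "v \<in> W" for v
  proof -
    obtain z where z: "z \<in> V" "v = (f ^^ Suc (m k)) z"
      using v by (auto simp: W_def)
    have "\<forall>\<^sub>F l in sequentially. (f ^^ (m l - Suc (m k))) v = (f ^^ m l) z"
      using eventually_gt_at_top[of k] by eventually_elim (metis z(2) split')
    then show ?thesis
      using esc[OF z(1)] filterlim_cong[OF refl refl] by fast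
  qed
  have ret: "(\<lambda>l. (f ^^ (m l - m k)) w) \<longlonglongrightarrow> g \<zeta>"
  proof -
    have "\<forall>\<^sub>F l in sequentially. (f ^^ Suc (m l)) \<zeta> = (f ^^ (m l - m k)) w"
      using eventually_ge_at_top[of k] by eventually_elim (metis w_def split)
    then show ?thesis
      by (rule Lim_transform_eventually[OF ptw[OF \<zeta>]])
  qed
  have gW: "g \<zeta> \<in> W" using k by (simp add: W_def)
  have "\<forall>\<^sub>F l in sequentially. (f ^^ (m l - m k)) w \<in> W"
    using ret \<open>open W\<close> gW by (rule topological_tendstoD)
  then have "\<forall>\<^sub>F l in sequentially. (f ^^ (m l - m k)) w \<in> W \<and> k < l"
    using eventually_gt_at_top[of k] by (rule eventually_conj)
  \<comment> \<open>A single return to \<open>W\<close> suffices: by \<open>escW\<close> the return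
    point escapes under the iterates \<open>f ^^ (m l - Suc (m k))\<close>.\<close>
  then obtain l' where l': "(f ^^ (m l' - m k)) w \<in> W" "k < l'"
    by (auto dest: eventually_happens)
  \<comment> \<open>One iteration less than the return time \<open>m l' - m k\<close>. Then
    \<open>p + (m l - m k)\<close> equals \<open>(m l - Suc (m k)) + (m l' - m k)\<close>, so the
    same iterate of \<open>w\<close> can be split in two ways: one gives a finite limit by
    continuity at \<open>g \<zeta>\<close>, the other escapes.\<close>
  define p where "p = m l' - Suc (m k)"
  have p: "m l' - m k = Suc p"
    using strict_monoD[OF m l'(2)] by (simp add: p_def)
  have "continuous_on W (f ^^ p)"
    by (intro holomorphic_on_imp_continuous_on holomorphic_on_funpow[OF f defW])
  then have "isCont (f ^^ p) (g \<zeta>)"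
    using \<open>open W\<close> gW by (simp add: continuous_on_eq_continuous_at)
  then have fin: "(\<lambda>l. (f ^^ p) ((f ^^ (m l - m k)) w)) \<longlonglongrightarrow> (f ^^ p) (g \<zeta>)"
    using ret by (rule isCont_tendsto_compose)
  have "\<forall>\<^sub>F l in sequentially.
      (f ^^ p) ((f ^^ (m l - m k)) w) = (f ^^ (m l - Suc (m k))) ((f ^^ (m l' - m k)) w)"
    using eventually_gt_at_top[of k]
  proof eventually_elim
    fix l assume "k < l"
    then have "p + (m l - m k) = (m l - Suc (m k)) + (m l' - m k)"
      using strict_monoD[OF m \<open>k < l\<close>] p by simp
    then show "(f ^^ p) ((f ^^ (m l - m k)) w) = (f ^^ (m l - Suc (m k))) ((f ^^ (m l' - m k)) w)"
      by (metis comp_apply funpow_add)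
  qed
  then have "(\<lambda>l. (f ^^ (m l - Suc (m k))) ((f ^^ (m l' - m k)) w)) \<longlonglongrightarrow> (f ^^ p) (g \<zeta>)"
    by (rule Lim_transform_eventually[OF fin])
  from not_tendsto_and_filterlim_at_infinity[OF sequentially_bot this] escW[OF l'(1)]
  show False by simp
qed

text \<open>Otherwise the entire function \<open>1 / (f - \<alpha>)\<close> would be bounded by
  \<open>1 / d\<close> on surrounding sets arbitrarily far out, hence constant, and \<open>f\<close>
  would be rational.\<close>

lemma not_eventually_far_from_omitted_value:
  assumes f: "f nicely_meromorphic_on UNIV" "\<not> rational_function f" "omitted_value f (Some \<alpha>)"
    and G: "compact G" "\<And>z. z \<in> G \<Longrightarrow> iterates_defined f z"
    and esc: "uniformly_to_infinity_on G (\<lambda>k. f ^^ m k)"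
    and surr: "\<forall>\<^sub>F k in sequentially. surrounds ((f ^^ m k) ` G) (Some \<alpha>)"
    and "d > 0"
  shows "\<not> (\<forall>\<^sub>F k in sequentially. \<forall>z\<in>G. dist ((f ^^ Suc (m k)) z) \<alpha> \<ge> d)"
proof
  assume far: "\<forall>\<^sub>F k in sequentially. \<forall>z\<in>G. dist ((f ^^ Suc (m k)) z) \<alpha> \<ge> d"
  let ?h = "\<lambda>z. if is_pole f z then 0 else inverse (f z - \<alpha>)"
  have ex: "\<exists>K. closed K \<and> surrounds K (Some \<alpha>) \<and> (\<forall>w\<in>K. norm w > R \<and> norm (?h w) \<le> inverse d)" for R
  proof -
    have "\<forall>\<^sub>F k in sequentially. \<forall>z\<in>G. norm ((f ^^ m k) z) > R"
      using esc by (auto simp: uniformly_to_infinity_on_def)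
    with surr far have "\<forall>\<^sub>F k in sequentially. surrounds ((f ^^ m k) ` G) (Some \<alpha>) \<and>
        (\<forall>z\<in>G. dist ((f ^^ Suc (m k)) z) \<alpha> \<ge> d) \<and> (\<forall>z\<in>G. norm ((f ^^ m k) z) > R)"
      by eventually_elim blast
    then obtain k where k: "surrounds ((f ^^ m k) ` G) (Some \<alpha>)"
        "\<And>z. z \<in> G \<Longrightarrow> dist ((f ^^ Suc (m k)) z) \<alpha> \<ge> d" "\<And>z. z \<in> G \<Longrightarrow> norm ((f ^^ m k) z) > R"
      using eventually_happens'[OF sequentially_bot] by blast
    have "closed ((f ^^ m k) ` G)"
      using G holomorphic_on_funpow[OF f(1)] holomorphic_on_imp_continuous_on
      by (intro compact_imp_closed compact_continuous_image) auto
    moreover have "norm (?h w) \<le> inverse d" if w: "w \<in> (f ^^ m k) ` G" for w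
    proof -
      have "norm (f w - \<alpha>) \<ge> d"
        using w k(2) by (auto simp: dist_norm)
      then show ?thesis
        using \<open>d > 0\<close> by (auto simp: norm_inverse le_imp_inverse_le)
    qed
    ultimately show ?thesis
      using k(1,3) by (intro exI[of _ "(f ^^ m k) ` G"]) auto
  qed
  obtain c where c: "\<And>z. ?h z = c"
    by (rule entire_bounded_on_surrounding_sets_imp_constant[OF holomorphic_inverse_of_omitted[OF f(1,3)] ex])
      blast
  show False
    using rational_function_if_inverse_constant[OF f(1) c] f(2) by simp
qed

lemma frequently_sequentially_obtain_subseq:
  assumes "\<exists>\<^sub>F k in sequentially. P k"
  obtains \<sigma> :: "nat \<Rightarrow> nat" where "strict_mono \<sigma>" "\<And>k. P (\<sigma> k)"
proof -
  have "infinite {k. P k}"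
    using assms frequently_cofinite cofinite_eq_sequentially by metis
  then show thesis
    using infinite_enumerate[of "{k. P k}"] that by auto
qed

text \<open>If convergence failed, normality would give a subsequence with a limit that is either a
  constant other than \<open>\<alpha>\<close> or infinity; both keep \<open>f\<close> away from
  \<open>\<alpha>\<close> on the curves.\<close>

lemma next_iterate_tends_to_omitted_value:
  fixes m :: "nat \<Rightarrow> nat"
  assumes f: "f nicely_meromorphic_on UNIV" "\<not> rational_function f" "omitted_value f (Some \<alpha>)"
    and G: "compact G" "connected G" "G \<noteq> {}" "G \<subseteq> fatou_set f"
    and m: "strict_mono m" "\<And>k. m k > 0"
    and esc: "uniformly_to_infinity_on G (\<lambda>k. f ^^ m k)"
    and surr: "\<forall>\<^sub>F k in sequentially. surrounds ((f ^^ m k) ` G) (Some \<alpha>)"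
  shows "uniform_limit G (\<lambda>k. f ^^ Suc (m k)) (\<lambda>_. \<alpha>) sequentially"
proof (rule ccontr)
  assume "\<not> ?thesis"
  then obtain e where e: "e > 0"
      "\<exists>\<^sub>F k in sequentially. \<exists>z\<in>G. \<not> dist ((f ^^ Suc (m k)) z) \<alpha> < e"
    unfolding uniform_limit_iff not_eventually by (auto simp: not_eventually)
  obtain \<sigma> :: "nat \<Rightarrow> nat" where \<sigma>: "strict_mono \<sigma>"
      "\<And>k. \<exists>z\<in>G. \<not> dist ((f ^^ Suc (m (\<sigma> k))) z) \<alpha> < e"
    using frequently_sequentially_obtain_subseq[OF e(2)] by blast
  obtain V where V: "open V" "connected V" "G \<subseteq> V" and def: "\<And>z. z \<in> V \<Longrightarrow> iterates_defined f z"
    and norm: "\<And>s :: nat \<Rightarrow> nat. (\<And>k. s k > 0) \<Longrightarrow>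
       \<exists>r :: nat \<Rightarrow> nat. strict_mono r \<and> iterates_converge_on f V (\<lambda>k. s (r k))"
    by (rule uniformly_normal_neighbourhood[OF G]) blast
  obtain r :: "nat \<Rightarrow> nat" where r: "strict_mono r" "iterates_converge_on f V (\<lambda>k. m (\<sigma> (r k)))"
    using norm[of "\<lambda>k. m (\<sigma> k)"] m(2) by blast
  \<comment> \<open>The second extraction refines the first, so both
    \<open>f ^^ m (\<rho> k)\<close> and its successor \<open>f ^^ Suc (m (\<rho> k))\<close> are
    controlled on \<open>V\<close>.\<close>
  obtain t :: "nat \<Rightarrow> nat" where t: "strict_mono t"
      "iterates_converge_on f V (\<lambda>k. Suc (m (\<sigma> (r (t k)))))"
    using norm[of "\<lambda>k. Suc (m (\<sigma> (r k)))"] by blast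
  define \<rho> where "\<rho> k = \<sigma> (r (t k))" for k
  have \<rho>: "strict_mono \<rho>"
    using \<sigma>(1) r(1) t(1) by (auto simp: strict_mono_def \<rho>_def)
  have esc\<rho>: "uniformly_to_infinity_on G (\<lambda>k. f ^^ m (\<rho> k))"
    using uniformly_to_infinity_on_subseq[OF esc \<rho>] .
  have surr\<rho>: "\<forall>\<^sub>F k in sequentially. surrounds ((f ^^ m (\<rho> k)) ` G) (Some \<alpha>)"
    using eventually_subseq[OF \<rho> surr] .
  have defG: "iterates_defined f z" if "z \<in> G" for z
    using def V(3) that by blast
  have not_far: False if "\<forall>\<^sub>F k in sequentially. \<forall>z\<in>G. dist ((f ^^ Suc (m (\<rho> k))) z) \<alpha> \<ge> d" "d > 0" for d
    using not_eventually_far_from_omitted_value[OF f G(1) defG esc\<rho> surr\<rho> that(2)] that(1) by contradiction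
  \<comment> \<open>Escape at one point of \<open>G\<close> excludes a finite limit, so the other
    alternative holds on all of \<open>V\<close>.\<close>
  have escV: "uniformly_to_infinity_on V (\<lambda>k. f ^^ m (\<rho> k))"
  proof -
    obtain z where z: "z \<in> G" using G(3) by blast
    have "\<not> uniform_limit V (\<lambda>k. f ^^ m (\<rho> k)) g sequentially" for g
    proof
      assume "uniform_limit V (\<lambda>k. f ^^ m (\<rho> k)) g sequentially"
      then have "(\<lambda>k. (f ^^ m (\<rho> k)) z) \<longlonglongrightarrow> g z"
        by (rule tendsto_uniform_limitI) (use z V(3) in blast)
      with uniformly_to_infinity_on_imp_filterlim[OF esc\<rho> z] show False
        using not_tendsto_and_filterlim_at_infinity[OF sequentially_bot] by blast
    qed
    moreover have "iterates_converge_on f V (\<lambda>k. m (\<rho> k))"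
      using iterates_converge_on_subseq[OF r(2) t(1)] by (simp only: \<rho>_def)
    ultimately show ?thesis
      unfolding iterates_converge_on_def by blast
  qed
  have "\<nexists>g. uniform_limit V (\<lambda>k. f ^^ Suc (m (\<rho> k))) g sequentially"
  proof
    assume "\<exists>g. uniform_limit V (\<lambda>k. f ^^ Suc (m (\<rho> k))) g sequentially"
    then obtain g where g: "uniform_limit V (\<lambda>k. f ^^ Suc (m (\<rho> k))) g sequentially" by blast
    have "strict_mono (\<lambda>k. m (\<rho> k))"
      using m(1) \<rho> by (simp add: strict_mono_def)
    then have "g constant_on V"
      using limit_after_escape_constant[OF f(1) V(1,2) def, of "\<lambda>k. m (\<rho> k)" g] g
        uniformly_to_infinity_on_imp_filterlim[OF escV] by blast
    then obtain c where c: "\<And>z. z \<in> V \<Longrightarrow> g z = c"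
      by (auto simp: constant_on_def)
    have near: "\<forall>\<^sub>F k in sequentially. \<forall>z\<in>G. dist ((f ^^ Suc (m (\<rho> k))) z) c < d" if d: "d > 0" for d
      using uniform_limitD[OF g d] by eventually_elim (metis V(3) c subsetD)
    show False
    proof (cases "c = \<alpha>")
      case True
      \<comment> \<open>Here the subsequence comes closer than \<open>e\<close> to
        \<open>\<alpha>\<close> on \<open>G\<close>, against the choice of
        \<open>\<sigma>\<close>.\<close>
      obtain k where "\<forall>z\<in>G. dist ((f ^^ Suc (m (\<rho> k))) z) \<alpha> < e"
        using eventually_happens'[OF sequentially_bot near[OF e(1)]] True by blast
      then show False using \<sigma>(2) by (metis \<rho>_def)
    next
      case False
      \<comment> \<open>Half the distance: points within \<open>d\<close> of \<open>c\<close> stay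
        at least \<open>d\<close> away from \<open>\<alpha>\<close>.\<close>
      define d where "d = dist c \<alpha> / 2"
      have "d > 0" using False by (simp add: d_def)
      have "\<forall>\<^sub>F k in sequentially. \<forall>z\<in>G. dist ((f ^^ Suc (m (\<rho> k))) z) \<alpha> \<ge> d"
        using near[OF \<open>d > 0\<close>]
      proof eventually_elim
        case (elim k)
        show ?case
        proof
          fix z assume "z \<in> G"
          with elim have "dist ((f ^^ Suc (m (\<rho> k))) z) c < d" by blast
          then show "dist ((f ^^ Suc (m (\<rho> k))) z) \<alpha> \<ge> d"
            using dist_triangle3[of c \<alpha> "(f ^^ Suc (m (\<rho> k))) z"] by (simp add: d_def)
        qed
      qed
      from not_far[OF this \<open>d > 0\<close>] show False .
    qed
  qed
  then have "uniformly_to_infinity_on V (\<lambda>k. f ^^ Suc (m (\<rho> k)))"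
    using t(2) unfolding iterates_converge_on_def \<rho>_def by blast
  then have "\<forall>\<^sub>F k in sequentially. \<forall>z\<in>V. norm ((f ^^ Suc (m (\<rho> k))) z) > norm \<alpha> + 1"
    unfolding uniformly_to_infinity_on_def by blast
  then have "\<forall>\<^sub>F k in sequentially. \<forall>z\<in>G. dist ((f ^^ Suc (m (\<rho> k))) z) \<alpha> \<ge> 1"
  proof eventually_elim
    case (elim k)
    show ?case
    proof
      fix z assume "z \<in> G"
      with elim V(3) have "norm ((f ^^ Suc (m (\<rho> k))) z) > norm \<alpha> + 1" by blast
      then show "dist ((f ^^ Suc (m (\<rho> k))) z) \<alpha> \<ge> 1"
        using norm_triangle_ineq2[of "(f ^^ Suc (m (\<rho> k))) z" \<alpha>] by (simp add: dist_norm)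
    qed
  qed
  from not_far[OF this zero_less_one] show False .
qed

section \<open>Preimages of spherical balls and their boundaries\<close>

text \<open>A form of the Cauchy-Schwarz inequality. It keeps the argument of \<open>arcsin\<close>
  in \<open>spherical_dist\<close> at most 1, where \<open>arcsin\<close> is continuous.\<close>

lemma norm_diff_le_stereographic_factors:
  fixes x y :: complex
  shows "norm (x - y) \<le> sqrt (1 + (norm x)\<^sup>2) * sqrt (1 + (norm y)\<^sup>2)"
proof -
  have "norm (x - y) \<le> norm x + norm y"
    by (rule norm_triangle_ineq4)
  also have "\<dots> = sqrt ((norm x + norm y)\<^sup>2)"
    by simp
  also have "\<dots> \<le> sqrt ((1 + (norm x)\<^sup>2) * (1 + (norm y)\<^sup>2))"
  proof (rule real_sqrt_le_mono)
    have "0 \<le> (norm x * norm y - 1)\<^sup>2" by simp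
    then show "(norm x + norm y)\<^sup>2 \<le> (1 + (norm x)\<^sup>2) * (1 + (norm y)\<^sup>2)"
      by (simp add: power2_eq_square algebra_simps)
  qed
  finally show ?thesis by (simp add: real_sqrt_mult)
qed

lemma continuous_on_spherical_dist:
  "continuous_on UNIV (\<lambda>z. spherical_dist (Some \<alpha>) (Some z))"
proof -
  have pos: "sqrt (1 + (norm z)\<^sup>2) > 0" for z :: complex
    by (simp add: add_pos_nonneg)
  have "norm (\<alpha> - z) / (sqrt (1 + (norm \<alpha>)\<^sup>2) * sqrt (1 + (norm z)\<^sup>2)) \<le> 1" for z
    using norm_diff_le_stereographic_factors[of \<alpha> z] pos by (simp add: divide_le_eq_1_pos)
  moreover have "norm (\<alpha> - z) / (sqrt (1 + (norm \<alpha>)\<^sup>2) * sqrt (1 + (norm z)\<^sup>2)) \<ge> -1" for z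
    using pos by (intro order_trans[OF _ divide_nonneg_pos]) auto
  moreover have "sqrt (1 + (norm z)\<^sup>2) \<noteq> 0" for z :: complex
    using pos[of z] by linarith
  ultimately show ?thesis
    by (auto intro!: continuous_intros)
qed

text \<open>The bound on \<open>r\<close> keeps infinity out of the ball, so the preimage contains
  no poles and \<open>f\<close> is continuous on the relevant set.\<close>

lemma open_vimage_spherical_ball:
  assumes f: "f nicely_meromorphic_on UNIV" and r: "r \<le> spherical_dist (Some \<alpha>) None"
  shows "open (sphere_val f -` spherical_ball (Some \<alpha>) r)"
proof -
  let ?N = "{z. \<not> is_pole f z}" and ?\<phi> = "\<lambda>z. spherical_dist (Some \<alpha>) (Some (f z))"
  have "sphere_val f -` spherical_ball (Some \<alpha>) r = ?N \<inter> ?\<phi> -` {..<r}"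
    using r by (auto simp: sphere_val_def spherical_ball_def simp del: spherical_dist.simps split: if_splits)
  moreover have "continuous_on ?N ?\<phi>"
    using nicely_meromorphic_on_imp_holomorphic_on[OF f, of ?N] holomorphic_on_imp_continuous_on
    by (intro continuous_on_compose2[OF continuous_on_spherical_dist]) auto
  then have "open (?N \<inter> ?\<phi> -` {..<r})"
    using open_nonpoles[OF f] by (intro continuous_open_preimage) auto
  ultimately show ?thesis by simp
qed

text \<open>An open set is disjoint from its frontier, so \<open>C\<close> cannot cross a set
  \<open>K\<close> inside \<open>S\<close>. Taking \<open>K\<close> so far out that it surrounds a
  point of \<open>C\<close> traps all of \<open>C\<close> in a bounded component.\<close>

lemma surrounding_sets_in_open_imp_frontier_components_bounded:
  assumes S: "open S" "C \<in> components (frontier S)"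
    and ex: "\<And>R. \<exists>K. K \<subseteq> S \<and> surrounds K (Some \<alpha>) \<and> (\<forall>w\<in>K. norm w > R)"
  shows "bounded C"
proof -
  obtain c where c: "c \<in> C"
    using in_components_nonempty[OF S(2)] by blast
  define R where "R = max (norm \<alpha>) (norm c)"
  obtain K D where K: "K \<subseteq> S" "\<And>w. w \<in> K \<Longrightarrow> norm w > R"
      and D: "D \<in> components (- K)" "bounded D" "\<alpha> \<in> D"
    using ex[of R] by (auto simp: surrounds_def)
  have "c \<in> D"
    using cball_subset_complement_component[of D K \<alpha> R] K D by (auto simp: R_def)
  moreover have "C \<subseteq> - K"
    using in_components_subset[OF S(2)] \<open>K \<subseteq> S\<close> \<open>open S\<close> by (auto simp: frontier_def interior_open)
  ultimately have "C \<subseteq> D"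
    using components_maximal[OF D(1) in_components_connected[OF S(2)]] c by blast
  with D(2) show ?thesis by (rule bounded_subset)
qed

theorem theorem3p3:
  fixes f :: "complex \<Rightarrow> complex" and a :: "complex option"
    and \<gamma> :: "real \<Rightarrow> complex" and m :: "nat \<Rightarrow> nat"
  assumes "f \<in> class_M"
    and "{b. omitted_value f b} = {a}"
    and "a \<in> julia_set f"
    and "julia_component f a = {a}"
    and "jordan_curve \<gamma>"
    and "path_image \<gamma> \<subseteq> fatou_set f"
    and "\<not> contractible_loop_in (fatou_set f) \<gamma>"
    and "strict_mono m" and "\<And>k. m k > 0"
    and "uniformly_to_infinity_on (path_image \<gamma>) (\<lambda>k. f ^^ m k)"
    and "\<forall>\<^sub>F k in sequentially. surrounds (path_image ((f ^^ m k) \<circ> \<gamma>)) a"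
  shows "\<exists>b. baker_omitted_value f b"
proof -
  have f: "f nicely_meromorphic_on UNIV" "\<not> rational_function f"
    using assms(1) by (auto simp: class_M_def transcendental_meromorphic_def)
  define G where "G = path_image \<gamma>"
  have "path \<gamma>"
    using assms(5) by (simp add: jordan_curve_def simple_path_def)
  then have G: "compact G" "connected G" "G \<noteq> {}" "G \<subseteq> fatou_set f"
    using assms(6) by (auto simp: G_def)
  have surr: "\<forall>\<^sub>F k in sequentially. surrounds ((f ^^ m k) ` G) a"
    using assms(11) by (simp add: G_def path_image_compose)
  then obtain k where "surrounds ((f ^^ m k) ` G) a"
    using eventually_happens'[OF sequentially_bot] by blast
  then obtain \<alpha> where \<alpha>: "a = Some \<alpha>"
    by (auto simp: surrounds_def)
  have om: "omitted_value f (Some \<alpha>)"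
    using assms(2) \<alpha> by blast
  have esc: "uniformly_to_infinity_on G (\<lambda>k. f ^^ m k)"
    using assms(10) by (simp add: G_def)
  have lim: "uniform_limit G (\<lambda>k. f ^^ Suc (m k)) (\<lambda>_. \<alpha>) sequentially"
    using next_iterate_tends_to_omitted_value[OF f om G assms(8,9) esc] surr \<alpha> by simp
  have def: "iterates_defined f z" if "z \<in> G" for z
    using that G(4) by (auto simp: fatou_set_def)
  \<comment> \<open>The distance from \<open>\<alpha>\<close> to infinity serves as the threshold
    radius in the definition of a Baker omitted value.\<close>
  have "bounded C"
    if r: "0 < r" "r < spherical_dist (Some \<alpha>) None"
      and C: "C \<in> components (frontier (sphere_val f -` spherical_ball (Some \<alpha>) r))" for r C
  proof (rule surrounding_sets_in_open_imp_frontier_components_bounded[OF _ C])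
    show "open (sphere_val f -` spherical_ball (Some \<alpha>) r)"
      using r by (intro open_vimage_spherical_ball[OF f(1)]) simp
    \<comment> \<open>The limit \<open>lim\<close> is Euclidean, so a Euclidean disc inside the
      spherical ball is needed.\<close>
    have "open {z. spherical_dist (Some \<alpha>) (Some z) < r}"
      by (intro open_Collect_less continuous_on_spherical_dist continuous_on_const)
    moreover have "spherical_dist (Some \<alpha>) (Some \<alpha>) < r"
      using r(1) by simp
    ultimately obtain d where d: "d > 0" "ball \<alpha> d \<subseteq> {z. spherical_dist (Some \<alpha>) (Some z) < r}"
      by (metis (no_types, lifting) mem_Collect_eq open_contains_ball)
    fix R
    have "\<forall>\<^sub>F k in sequentially. \<forall>z\<in>G. norm ((f ^^ m k) z) > R"
      using esc by (auto simp: uniformly_to_infinity_on_def)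
    with surr uniform_limitD[OF lim d(1)]
    have "\<forall>\<^sub>F k in sequentially. surrounds ((f ^^ m k) ` G) a \<and>
        (\<forall>z\<in>G. dist ((f ^^ Suc (m k)) z) \<alpha> < d) \<and> (\<forall>z\<in>G. norm ((f ^^ m k) z) > R)"
      by eventually_elim blast
    then obtain k where k: "surrounds ((f ^^ m k) ` G) a"
        "\<And>z. z \<in> G \<Longrightarrow> dist ((f ^^ Suc (m k)) z) \<alpha> < d" "\<And>z. z \<in> G \<Longrightarrow> norm ((f ^^ m k) z) > R"
      using eventually_happens'[OF sequentially_bot] by blast
    have "(f ^^ m k) ` G \<subseteq> sphere_val f -` spherical_ball (Some \<alpha>) r"
    proof (rule image_subsetI)
      fix z assume z: "z \<in> G"
      \<comment> \<open>Orbits starting in the Fatou set avoid poles, so here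
        \<open>sphere_val f\<close> is the genuine value of \<open>f\<close> and not
        infinity.\<close>
      have "\<not> is_pole f ((f ^^ m k) z)"
        using def[OF z] by (simp add: iterates_defined_def)
      moreover have "spherical_dist (Some \<alpha>) (Some (f ((f ^^ m k) z))) < r"
        using d(2) k(2)[OF z] by (auto simp: dist_commute simp del: spherical_dist.simps)
      ultimately show "(f ^^ m k) z \<in> sphere_val f -` spherical_ball (Some \<alpha>) r"
        by (simp add: sphere_val_def spherical_ball_def del: spherical_dist.simps)
    qed
    with k(1,3) \<alpha> show "\<exists>K\<subseteq>sphere_val f -` spherical_ball (Some \<alpha>) r.
        surrounds K (Some \<alpha>) \<and> (\<forall>w\<in>K. norm w > R)"
      by (intro exI[of _ "(f ^^ m k) ` G"]) auto
  qed
  moreover have "spherical_dist (Some \<alpha>) None > 0"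
    using arcsin_less_mono[of 0 "1 / sqrt (1 + (norm \<alpha>)\<^sup>2)"] by (simp add: add_pos_nonneg)
  ultimately have "baker_omitted_value f (Some \<alpha>)"
    using om unfolding baker_omitted_value_def by blast
  then show ?thesis ..
qed

end
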